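(* Let $T_n$ denote the transitive tournament on $n$ vertices and $b(T_n)$ its bar visibility number. The sequence $b(T_n)/n$ converges as $n\to\infty$.
   Context: Digraphs are finite, without loops or multiple arcs. A bar is a horizontal line segment of positive length in the plane; bars do not overlap (bars at the same height may at most share an endpoint). A channel is a vertical strip of positive width. One bar sees another bar above it if there is an unblocked channel between them, i.e. a vertical strip of positive width meeting both bars such that no other bar meets the part of the strip between the two. A $t$-bar visibility representation of a digraph $G$ assigns each vertex at most $t$ bars in the plane so that, for distinct vertices $x,y$, there is an arc $xy$ (from $x$ to $y$) in $G$ if and only if some bar for $x$ sees some bar for $y$ above it along an unblocked channel (visibilities between two bars of the same vertex are ignored). The bar visibility number $b(G)$ is the least $t$ such that $G$ has a $t$-bar visibility representation. The transitive tournament $T_n$ is the digraph on $v_1,\ldots,v_n$ with arc set $\{v_iv_j : i<j\}$. *)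

theory Defs
  imports "HOL-Analysis.Analysis" "Graph_Theory.Graph_Theory"
begin

datatype bar = Bar (lft: real) (rgt: real) (hgt: real)

definition segment :: "bar \<Rightarrow> (real \<times> real) set" where
  "segment p = {lft p..rgt p} \<times> {hgt p}"

definition is_bar :: "bar \<Rightarrow> bool" where
  "is_bar p \<longleftrightarrow> lft p < rgt p"

text \<open>For two bars at the same height, ``no overlap'' means that one lies weakly to the left of
  the other, so that they have at most an endpoint in common.\<close>

definition non_overlapping :: "bar \<Rightarrow> bar \<Rightarrow> bool" where
  "non_overlapping p q \<longleftrightarrow> (hgt p = hgt q \<longrightarrow> rgt p \<le> lft q \<or> rgt q \<le> lft p)"

text \<open>Bar \<open>p\<close> sees the higher bar \<open>q\<close> within a set \<open>S\<close> of bars: the channel over \<open>[a, b]\<close> crosses both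
  bars in its full width, and no bar of \<open>S\<close> meets its part strictly between the heights of \<open>p\<close>
  and \<open>q\<close>. The boundary lines of the channel are left out of the blocking condition; since a
  channel can always be narrowed, including them would give the same relation. Neither \<open>p\<close> nor
  \<open>q\<close> can meet the open rectangle, so \<open>S\<close> may contain them.\<close>

definition sees :: "bar set \<Rightarrow> bar \<Rightarrow> bar \<Rightarrow> bool" where
  "sees S p q \<longleftrightarrow> hgt p < hgt q \<and>
     (\<exists>a b. a < b \<and> {a..b} \<times> {hgt p} \<subseteq> segment p \<and> {a..b} \<times> {hgt q} \<subseteq> segment q \<and>
        (\<forall>c\<in>S. segment c \<inter> ({a<..<b} \<times> {hgt p<..<hgt q}) = {}))"

text \<open>\<open>B x\<close> is the set of bars assigned to the vertex \<open>x\<close>. The pairs \<open>(x, p)\<close> and \<open>(y, q)\<close> in the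
  third conjunct also range over bars of different vertices; in particular, a bar
  cannot be shared by two vertices. Bars of any vertex, including \<open>x\<close> and \<open>y\<close>, can block.\<close>

definition bar_visibility_rep :: "nat \<Rightarrow> ('a, 'b) pre_digraph \<Rightarrow> ('a \<Rightarrow> bar set) \<Rightarrow> bool" where
  "bar_visibility_rep t G B \<longleftrightarrow>
     (\<forall>x\<in>verts G. finite (B x) \<and> card (B x) \<le> t) \<and>
     (\<forall>x\<in>verts G. \<forall>p\<in>B x. is_bar p) \<and>
     (\<forall>x\<in>verts G. \<forall>y\<in>verts G. \<forall>p\<in>B x. \<forall>q\<in>B y. (x, p) \<noteq> (y, q) \<longrightarrow> non_overlapping p q) \<and>
     (\<forall>x\<in>verts G. \<forall>y\<in>verts G. x \<noteq> y \<longrightarrow>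
        (x \<rightarrow>\<^bsub>G\<^esub> y \<longleftrightarrow> (\<exists>p\<in>B x. \<exists>q\<in>B y. sees (\<Union>z\<in>verts G. B z) p q)))"

definition bar_visibility_number :: "('a, 'b) pre_digraph \<Rightarrow> nat" where
  "bar_visibility_number G = (LEAST t. \<exists>B. bar_visibility_rep t G B)"

definition transitive_tournament :: "nat \<Rightarrow> nat pair_pre_digraph" where
  "transitive_tournament n =
     \<lparr> pverts = {1..n}, parcs = {(i, j). i \<in> {1..n} \<and> j \<in> {1..n} \<and> i < j} \<rparr>"

lemma pair_digraph_transitive_tournament: "pair_digraph (transitive_tournament n)"
proof
  have "parcs (transitive_tournament n) \<subseteq> {1..n} \<times> {1..n}"
    by (auto simp: transitive_tournament_def)
  then show "finite (parcs (transitive_tournament n))"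
    by (rule finite_subset) auto
qed (auto simp: transitive_tournament_def)

text \<open>Every digraph has a bar visibility representation, so the minimum defining
  \<open>bar_visibility_number\<close> is attained: give each arc its own pair of stacked bars.\<close>

lemma bar_visibility_rep_exists:
  assumes "digraph G"
  shows "\<exists>t B. bar_visibility_rep t G B"
proof -
  interpret digraph G by fact
  obtain f :: "'b \<Rightarrow> nat" where f: "inj_on f (arcs G)"
    using finite_imp_inj_to_nat_seg[OF finite_arcs] by blast
  define lo where "lo e = Bar (2 * real (f e)) (2 * real (f e) + 1) 0" for e
  define up where "up e = Bar (2 * real (f e)) (2 * real (f e) + 1) 1" for e
  define B where "B x = lo ` {e \<in> arcs G. tail G e = x} \<union> up ` {e \<in> arcs G. head G e = x}" for x
  define t where "t = 2 * card (arcs G)"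
  note bars = lo_def up_def
  have fin: "finite (B x)" for x by (auto simp: B_def)
  have card: "card (B x) \<le> t" for x
  proof -
    have "card (B x) \<le> card (lo ` {e \<in> arcs G. tail G e = x}) + card (up ` {e \<in> arcs G. head G e = x})"
      unfolding B_def by (rule card_Un_le)
    also have "\<dots> \<le> card {e \<in> arcs G. tail G e = x} + card {e \<in> arcs G. head G e = x}"
      by (intro add_mono card_image_le) auto
    also have "\<dots> \<le> card (arcs G) + card (arcs G)"
      by (intro add_mono card_mono) auto
    finally show ?thesis by (simp add: t_def)
  qed
  have sep: "2 * real (f d) + 1 \<le> 2 * real (f e) \<or> 2 * real (f e) + 1 \<le> 2 * real (f d)"
    if "d \<in> arcs G" "e \<in> arcs G" "d \<noteq> e" for d e
  proof -
    have "f d \<noteq> f e" using that f by (auto dest: inj_onD)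
    then show ?thesis by linarith
  qed
  have no: "non_overlapping p q" if "p \<in> B x" "q \<in> B y" "(x, p) \<noteq> (y, q)" for x y p q
    using that sep by (fastforce simp: B_def non_overlapping_def bars)
  have empty: "segment c \<inter> (I \<times> {0<..<1}) = {}" if "c \<in> B z" for c z I
    using that by (auto simp: B_def segment_def bars)
  have vis: "x \<rightarrow>\<^bsub>G\<^esub> y \<longleftrightarrow> (\<exists>p\<in>B x. \<exists>q\<in>B y. sees (\<Union>z\<in>verts G. B z) p q)"
    if "x \<noteq> y" for x y
  proof
    assume "x \<rightarrow>\<^bsub>G\<^esub> y"
    then obtain e where e: "e \<in> arcs G" "tail G e = x" "head G e = y"
      by (auto simp: arcs_ends_conv)
    have "sees (\<Union>z\<in>verts G. B z) (lo e) (up e)"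
      unfolding sees_def
    proof (intro conjI exI)
      show "2 * real (f e) < 2 * real (f e) + 1" by simp
      show "\<forall>c\<in>(\<Union>z\<in>verts G. B z). segment c \<inter>
          ({2 * real (f e)<..<2 * real (f e) + 1} \<times> {hgt (lo e)<..<hgt (up e)}) = {}"
        using empty by (simp add: bars)
    qed (auto simp: bars segment_def)
    then show "\<exists>p\<in>B x. \<exists>q\<in>B y. sees (\<Union>z\<in>verts G. B z) p q"
      using e by (auto simp: B_def)
  next
    assume "\<exists>p\<in>B x. \<exists>q\<in>B y. sees (\<Union>z\<in>verts G. B z) p q"
    then obtain p q where pq: "p \<in> B x" "q \<in> B y" and s: "sees (\<Union>z\<in>verts G. B z) p q" by blast
    from s have h: "hgt p < hgt q" by (simp add: sees_def)
    then obtain d e where d: "d \<in> arcs G" "tail G d = x" "p = lo d"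
      and e: "e \<in> arcs G" "head G e = y" "q = up e"
      using pq by (auto simp: B_def bars)
    from s obtain a b where ab: "a < b" "{a..b} \<times> {hgt p} \<subseteq> segment p" "{a..b} \<times> {hgt q} \<subseteq> segment q"
      by (auto simp: sees_def)
    then have "lft p \<le> a \<and> b \<le> rgt p \<and> lft q \<le> a \<and> b \<le> rgt q"
      by (simp add: segment_def times_subset_iff)
    then have "d = e" using sep[of d e] d e ab(1) by (auto simp: bars)
    then show "x \<rightarrow>\<^bsub>G\<^esub> y" using d e by (auto simp: arcs_ends_conv)
  qed
  have "bar_visibility_rep t G B"
    unfolding bar_visibility_rep_def using fin card no vis
    by (auto simp: B_def is_bar_def bars)
  then show ?thesis by blast
qed

end

theory Submission
  imports Defs "HOL-Number_Theory.Cong"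
begin

text \<open>If an arrangement of bars represents a transitive tournament, then along every vertical line
  the indices weakly increase from bottom to top, so deleting vertices never creates a wrong
  visibility and \<open>b(T\<^sub>n)\<close> is monotone in \<open>n\<close>. To represent \<open>T\<^bsub>nk\<^esub>\<close>, blow up each vertex of \<open>T\<^sub>n\<close> to
  a group of \<open>k\<close> vertices, where \<open>k\<close> is coprime to \<open>n!\<close>. Place \<open>k\<^sup>2\<close> copies of an optimal
  representation of \<open>T\<^sub>n\<close> side by side, the copy \<open>(r, s)\<close> using member \<open>(ri + s) mod k\<close> of group \<open>i\<close>.
  Since \<open>j - i\<close> is invertible modulo \<open>k\<close>, every pair of vertices from different groups occurs in some
  copy, while each vertex is used in only \<open>k\<close> of them; each group is handled by a separate copy of
  \<open>T\<^sub>k\<close>. Hence \<open>b(T\<^bsub>nk\<^esub>) \<le> k b(T\<^sub>n) + b(T\<^sub>k) \<le> k (b(T\<^sub>n) + 1)\<close>. Since the admissible \<open>k\<close> include the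
  progression \<open>1 + m n!\<close>, monotonicity gives \<open>limsup b(T\<^sub>N)/N \<le> (b(T\<^sub>n) + 1)/n\<close> for every \<open>n\<close>.\<close>

section \<open>Arrangements of bars compatible with the order of the vertices\<close>

definition overlap :: "bar \<Rightarrow> bar \<Rightarrow> bool" where
  "overlap p q \<longleftrightarrow> max (lft p) (lft q) < min (rgt p) (rgt q)"

definition layout :: "(nat \<Rightarrow> bar set) \<Rightarrow> bool" where
  "layout B \<longleftrightarrow> finite (\<Union>x. B x) \<and> (\<forall>x. \<forall>p\<in>B x. is_bar p) \<and>
     (\<forall>x y. \<forall>p\<in>B x. \<forall>q\<in>B y. (x, p) \<noteq> (y, q) \<longrightarrow> non_overlapping p q) \<and>
     (\<forall>x y. \<forall>p\<in>B x. \<forall>q\<in>B y. hgt p < hgt q \<longrightarrow> overlap p q \<longrightarrow> x \<le> y)"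

definition realizes :: "(nat \<Rightarrow> bar set) \<Rightarrow> nat \<Rightarrow> nat \<Rightarrow> bool" where
  "realizes B x y \<longleftrightarrow> (\<exists>p\<in>B x. \<exists>q\<in>B y. sees (\<Union>z. B z) p q)"

text \<open>Only the arcs in \<open>E\<close> must appear: \<open>layout\<close> forces any further
  visibility between distinct vertices to go from the smaller index to the larger, which does no
  harm in a transitive tournament. The bound \<open>w\<close> depends on the vertex so that bounds
  add up when drawings are combined.\<close>

definition drawable :: "(nat \<Rightarrow> nat) \<Rightarrow> (nat \<times> nat) set \<Rightarrow> bool" where
  "drawable w E \<longleftrightarrow> (\<exists>B. layout B \<and> (\<forall>x. card (B x) \<le> w x) \<and> (\<forall>(x, y)\<in>E. realizes B x y))"

section \<open>Visibility in coordinates\<close>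

lemma sees_bars_iff:
  assumes "\<forall>c\<in>S. is_bar c"
  shows "sees S p q \<longleftrightarrow> hgt p < hgt q \<and> (\<exists>a b. a < b \<and> lft p \<le> a \<and> b \<le> rgt p \<and> lft q \<le> a \<and> b \<le> rgt q \<and>
     (\<forall>c\<in>S. hgt p < hgt c \<longrightarrow> hgt c < hgt q \<longrightarrow> rgt c \<le> a \<or> b \<le> lft c))"
proof -
  have free: "segment c \<inter> ({a<..<b} \<times> {hgt p<..<hgt q}) = {} \<longleftrightarrow>
      (hgt p < hgt c \<longrightarrow> hgt c < hgt q \<longrightarrow> rgt c \<le> a \<or> b \<le> lft c)"
    if "a < b" "c \<in> S" for a b c
  proof -
    \<comment> \<open>Both intervals have positive length, so they are disjoint only if one lies
      weakly beside the other.\<close>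
    have "{lft c..rgt c} \<inter> {a<..<b} = {} \<longleftrightarrow> rgt c \<le> a \<or> b \<le> lft c"
    proof
      assume e: "{lft c..rgt c} \<inter> {a<..<b} = {}"
      show "rgt c \<le> a \<or> b \<le> lft c"
      proof (rule ccontr)
        assume "\<not> ?thesis"
        then have "max (lft c) a < min (rgt c) b" using that assms by (auto simp: is_bar_def)
        then obtain u where "max (lft c) a < u" "u < min (rgt c) b" using dense by blast
        then have "u \<in> {lft c..rgt c} \<inter> {a<..<b}" by auto
        with e show False by blast
      qed
    qed auto
    then show ?thesis by (auto simp: segment_def Times_Int_Times)
  qed
  have sub: "{a..b} \<times> {hgt r} \<subseteq> segment r \<longleftrightarrow> lft r \<le> a \<and> b \<le> rgt r" if "a < b" for a b r
    using that by (auto simp: segment_def times_subset_iff)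
  show ?thesis
    unfolding sees_def by (simp add: free sub cong: conj_cong)
qed

lemma sees_overlap: "sees S p q \<Longrightarrow> hgt p < hgt q \<and> overlap p q"
  by (auto simp: sees_def overlap_def segment_def times_subset_iff)

lemma sees_subset: "sees S p q \<Longrightarrow> S' \<subseteq> S \<Longrightarrow> sees S' p q"
  unfolding sees_def by blast

lemma
  assumes "layout B"
  shows layout_finite: "finite (\<Union>x. B x)"
    and layout_is_bar: "p \<in> B x \<Longrightarrow> is_bar p"
    and layout_non_overlapping: "p \<in> B x \<Longrightarrow> q \<in> B y \<Longrightarrow> (x, p) \<noteq> (y, q) \<Longrightarrow> non_overlapping p q"
    and layout_order: "p \<in> B x \<Longrightarrow> q \<in> B y \<Longrightarrow> hgt p < hgt q \<Longrightarrow> overlap p q \<Longrightarrow> x \<le> y"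
proof -
  note conj = assms[unfolded layout_def]
  show "finite (\<Union>x. B x)" using conj by (rule conjunct1)
  show "is_bar p" if "p \<in> B x"
    using conj[THEN conjunct2, THEN conjunct1] that by blast
  show "non_overlapping p q" if "p \<in> B x" "q \<in> B y" "(x, p) \<noteq> (y, q)"
    using conj[THEN conjunct2, THEN conjunct2, THEN conjunct1] that by blast
  show "x \<le> y" if "p \<in> B x" "q \<in> B y" "hgt p < hgt q" "overlap p q"
    using conj[THEN conjunct2, THEN conjunct2, THEN conjunct2] that by blast
qed

text \<open>A bar blocking the common channel of two overlapping bars overlaps both of them, so the
  order condition passes from visible pairs to all overlapping pairs.\<close>

lemma sees_order_imp_overlap_order:
  assumes fin: "finite (\<Union>x. B x)" and bars: "\<And>x p. p \<in> B x \<Longrightarrow> is_bar p"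
    and ord: "\<And>x y p q. p \<in> B x \<Longrightarrow> q \<in> B y \<Longrightarrow> sees (\<Union>x. B x) p q \<Longrightarrow> x \<le> y"
    and "p \<in> B x" "q \<in> B y" "hgt p < hgt q" "overlap p q"
  shows "x \<le> (y :: nat)"
  using assms(4-)
proof (induction "card {c \<in> (\<Union>x. B x). hgt p < hgt c \<and> hgt c < hgt q}" arbitrary: x y p q rule: less_induct)
  case less
  let ?S = "\<Union>x. B x" and ?between = "\<lambda>p q. {c \<in> (\<Union>x. B x). hgt p < hgt c \<and> hgt c < hgt q}"
  have barsS: "\<forall>c\<in>?S. is_bar c" using bars by blast
  define a b where "a = max (lft p) (lft q)" and "b = min (rgt p) (rgt q)"
  have "a < b" using less.prems by (simp add: a_def b_def overlap_def)
  show ?case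
  proof (cases "sees ?S p q")
    case True
    then show ?thesis using ord less.prems by blast
  next
    case False
    \<comment> \<open>Without such a bar, the whole common strip over \<open>[a, b]\<close> would be
      a channel.\<close>
    have "\<exists>c\<in>?S. hgt p < hgt c \<and> hgt c < hgt q \<and> a < rgt c \<and> lft c < b"
    proof (rule ccontr)
      assume "\<not> ?thesis"
      then have "\<forall>c\<in>?S. hgt p < hgt c \<longrightarrow> hgt c < hgt q \<longrightarrow> rgt c \<le> a \<or> b \<le> lft c"
        by (meson not_le)
      then have "sees ?S p q"
        unfolding sees_bars_iff[OF barsS] using \<open>a < b\<close> less.prems(3)
        by (intro conjI exI[of _ a] exI[of _ b]) (simp_all add: a_def b_def)
      with False show False by contradiction
    qed
    then obtain c where "c \<in> ?S" and c: "hgt p < hgt c" "hgt c < hgt q" "a < rgt c" "lft c < b"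
      by blast
    then obtain z where z: "c \<in> B z" by blast
    have "lft c < rgt c" using bars[OF z] by (simp add: is_bar_def)
    then have ov: "overlap p c" "overlap c q"
      using c \<open>a < b\<close> by (auto simp: overlap_def a_def b_def)
    have "finite (?between p q)" using fin by (rule finite_subset[rotated]) auto
    \<comment> \<open>Strict, because \<open>c\<close> is counted between \<open>p\<close> and
      \<open>q\<close> but not between \<open>p\<close> and \<open>c\<close> or between
      \<open>c\<close> and \<open>q\<close>.\<close>
    then have "card (?between p c) < card (?between p q)" "card (?between c q) < card (?between p q)"
      using c z by (auto intro!: psubset_card_mono)
    then show ?thesis using less.hyps[of p c x z] less.hyps[of c q z y] less.prems z c ov
      by (meson order_trans)
  qed
qed

section \<open>Restricting, relabelling and juxtaposing arrangements\<close>

lemma layout_restrict: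
  assumes "layout B"
  shows "layout (\<lambda>x. if x \<in> V then B x else {})"
proof -
  have "(\<Union>x. if x \<in> V then B x else {}) \<subseteq> (\<Union>x. B x)" by (auto split: if_splits)
  then have fin: "finite (\<Union>x. if x \<in> V then B x else {})"
    using layout_finite[OF assms] by (rule finite_subset)
  show ?thesis
    unfolding layout_def
    by (intro conjI fin) (auto split: if_splits dest: layout_is_bar[OF assms]
        layout_non_overlapping[OF assms] layout_order[OF assms])
qed

lemma realizes_restrict:
  assumes "realizes B x y" "x \<in> V" "y \<in> V"
  shows "realizes (\<lambda>x. if x \<in> V then B x else {}) x y"
proof -
  have "(\<Union>x. if x \<in> V then B x else {}) \<subseteq> (\<Union>x. B x)" by (auto split: if_splits)
  then show ?thesis using assms sees_subset unfolding realizes_def by (simp, blast)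
qed

lemma drawable_restrict:
  assumes "drawable w E"
  shows "drawable (\<lambda>x. if x \<in> V then w x else 0) (E \<inter> V \<times> V)"
proof -
  obtain B where "layout B" "\<forall>x. card (B x) \<le> w x" "\<forall>(x, y)\<in>E. realizes B x y"
    using assms by (auto simp: drawable_def)
  then show ?thesis unfolding drawable_def
    by (intro exI[of _ "\<lambda>x. if x \<in> V then B x else {}"])
      (auto simp: layout_restrict intro!: realizes_restrict)
qed

lemma drawable_mono: "drawable w E \<Longrightarrow> (\<And>x. w x \<le> w' x) \<Longrightarrow> E' \<subseteq> E \<Longrightarrow> drawable w' E'"
  unfolding drawable_def by (meson order_trans subsetD)

text \<open>The bars stay in place and only change owners along \<open>g\<close>. Bars of vertices
  outside \<open>V\<close> are dropped, which can only open channels.\<close>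

lemma drawable_relabel:
  assumes "drawable w E" and g: "strict_mono_on V g"
  shows "drawable (\<lambda>z. if z \<in> g ` V then w (inv_into V g z) else 0) (map_prod g g ` (E \<inter> V \<times> V))"
proof -
  obtain B where B: "layout B" "\<forall>x. card (B x) \<le> w x" "\<forall>(x, y)\<in>E. realizes B x y"
    using assms by (auto simp: drawable_def)
  have inj: "inj_on g V" using g by (rule strict_mono_on_imp_inj_on)
  define C where "C z = (if z \<in> g ` V then B (inv_into V g z) else {})" for z
  have CI: "C (g x) = B x" if "x \<in> V" for x using that inj by (simp add: C_def)
  have CD: "\<exists>x\<in>V. z = g x \<and> p \<in> B x" if "p \<in> C z" for p z
    using that inj by (auto simp: C_def split: if_splits)
  have sub: "(\<Union>z. C z) \<subseteq> (\<Union>x. B x)" by (auto simp: C_def split: if_splits)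
  have mono: "g x \<le> g y" if "x \<in> V" "y \<in> V" "x \<le> y" for x y
    using g that by (metis strict_mono_onD le_less)
  have "layout C"
    unfolding layout_def
  proof (intro conjI allI ballI impI)
    show "finite (\<Union>z. C z)" using sub layout_finite[OF B(1)] by (rule finite_subset)
  next
    fix z p assume "p \<in> C z"
    then show "is_bar p" using CD layout_is_bar[OF B(1)] by blast
  next
    fix u v p q assume "p \<in> C u" "q \<in> C v" and ne: "(u, p) \<noteq> (v, q)"
    then obtain x y where "u = g x" "v = g y" and pq: "p \<in> B x" "q \<in> B y"
      by (elim CD[THEN bexE]) auto
    then have "(x, p) \<noteq> (y, q)" using ne by auto
    then show "non_overlapping p q" by (rule layout_non_overlapping[OF B(1) pq])
  next
    fix u v p q assume "p \<in> C u" "q \<in> C v" and ov: "hgt p < hgt q" "overlap p q"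
    then obtain x y where xy: "x \<in> V" "y \<in> V" "u = g x" "v = g y" "p \<in> B x" "q \<in> B y"
      by (elim CD[THEN bexE]) auto
    then show "u \<le> v" using mono layout_order[OF B(1) xy(5,6) ov] by simp
  qed
  moreover have "card (C z) \<le> (if z \<in> g ` V then w (inv_into V g z) else 0)" for z
    using B(2) by (auto simp: C_def)
  moreover have "realizes C (g x) (g y)" if "(x, y) \<in> E" "x \<in> V" "y \<in> V" for x y
  proof -
    have "realizes B x y" using B(3) that by auto
    then show ?thesis using that(2,3) sees_subset[OF _ sub] unfolding realizes_def by (simp add: CI, blast)
  qed
  ultimately show ?thesis unfolding drawable_def by (intro exI[of _ C]) auto
qed

definition shift :: "real \<Rightarrow> bar \<Rightarrow> bar" where
  "shift d p = Bar (lft p + d) (rgt p + d) (hgt p)"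

lemma shift_sel [simp]: "lft (shift d p) = lft p + d" "rgt (shift d p) = rgt p + d" "hgt (shift d p) = hgt p"
  by (simp_all add: shift_def)

lemma shift_inject [simp]: "shift d p = shift d q \<longleftrightarrow> p = q"
  by (cases p; cases q) (auto simp: shift_def)

text \<open>Two arrangements separated by a vertical line neither overlap nor block each other, so
  their visibilities simply accumulate.\<close>

lemma drawable_union:
  assumes "drawable w1 E1" "drawable w2 E2"
  shows "drawable (\<lambda>x. w1 x + w2 x) (E1 \<union> E2)"
proof -
  obtain A where A: "layout A" "\<forall>x. card (A x) \<le> w1 x" "\<forall>(x, y)\<in>E1. realizes A x y"
    using assms by (auto simp: drawable_def)
  obtain B where B: "layout B" "\<forall>x. card (B x) \<le> w2 x" "\<forall>(x, y)\<in>E2. realizes B x y"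
    using assms by (auto simp: drawable_def)
  have fA: "finite (\<Union>x. A x)" and fB: "finite (\<Union>x. B x)" using A(1) B(1) by (simp_all only: layout_finite)
  obtain M where M: "\<And>p. p \<in> (\<Union>x. A x) \<Longrightarrow> rgt p \<le> M"
    using bdd_above_finite[OF finite_imageI[OF fA, of rgt]] by (auto simp: bdd_above_def)
  obtain m where m: "\<And>p. p \<in> (\<Union>x. B x) \<Longrightarrow> m \<le> lft p"
    using bdd_below_finite[OF finite_imageI[OF fB, of lft]] by (auto simp: bdd_below_def)
  \<comment> \<open>This translation carries the left bound \<open>m\<close> of the second
    arrangement to the right bound \<open>M\<close> of the first, making the line at
    \<open>M\<close> separate them.\<close>
  define s where "s = shift (M - m)"
  define C where "C x = A x \<union> s ` B x" for x
  have AM: "lft p < rgt p" "rgt p \<le> M" if "p \<in> A x" for p x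
    using that M layout_is_bar[OF A(1) that] by (auto simp: is_bar_def)
  have BM: "lft p < rgt p" "M \<le> lft p + (M - m)" if "p \<in> B x" for p x
    using that m[of p] layout_is_bar[OF B(1) that] by (auto simp: is_bar_def)
  have barsC: "\<forall>c\<in>(\<Union>x. C x). is_bar c"
    using AM BM by (auto simp: C_def s_def is_bar_def)
  have barsA: "\<forall>c\<in>(\<Union>x. A x). is_bar c" and barsB: "\<forall>c\<in>(\<Union>x. B x). is_bar c"
    using layout_is_bar[OF A(1)] layout_is_bar[OF B(1)] by blast+
  have UC: "(\<Union>x. C x) = (\<Union>x. A x) \<union> s ` (\<Union>x. B x)" by (auto simp: C_def)
  have "layout C"
    unfolding layout_def
  proof (intro conjI allI ballI impI)
    show "finite (\<Union>x. C x)" using fA fB by (simp add: UC)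
  next
    fix z p assume "p \<in> C z"
    then show "is_bar p" using barsC by blast
  next
    fix x y p q assume pq: "p \<in> C x" "q \<in> C y" "(x, p) \<noteq> (y, q)"
    consider "p \<in> A x" "q \<in> A y" | p' where "p = s p'" "p' \<in> B x" "q \<in> A y"
      | q' where "p \<in> A x" "q = s q'" "q' \<in> B y"
      | p' q' where "p = s p'" "q = s q'" "p' \<in> B x" "q' \<in> B y"
      using pq by (auto simp: C_def)
    then show "non_overlapping p q"
    proof cases
      case 1
      then show ?thesis using layout_non_overlapping[OF A(1)] pq(3) by blast
    next
      case 2
      then show ?thesis using AM[of q y] BM[of p' x] by (auto simp: non_overlapping_def s_def)
    next
      case 3
      then show ?thesis using AM[of p x] BM[of q' y] by (auto simp: non_overlapping_def s_def)
    next
      case 4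
      then have "non_overlapping p' q'" using layout_non_overlapping[OF B(1), of p' x q' y] pq(3) by auto
      then show ?thesis using 4 by (auto simp: non_overlapping_def s_def)
    qed
  next
    fix x y p q assume pq: "p \<in> C x" "q \<in> C y" "hgt p < hgt q" "overlap p q"
    consider "p \<in> A x" "q \<in> A y" | p' where "p = s p'" "p' \<in> B x" "q \<in> A y"
      | q' where "p \<in> A x" "q = s q'" "q' \<in> B y"
      | p' q' where "p = s p'" "q = s q'" "p' \<in> B x" "q' \<in> B y"
      using pq by (auto simp: C_def)
    then show "x \<le> y"
    proof cases
      case 1
      then show ?thesis using layout_order[OF A(1)] pq(3,4) by blast
    next
      case 2
      then show ?thesis using AM[of q y] BM[of p' x] pq by (auto simp: overlap_def s_def)
    next
      case 3
      then show ?thesis using AM[of p x] BM[of q' y] pq by (auto simp: overlap_def s_def)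
    next
      case 4
      then have "hgt p' < hgt q'" "overlap p' q'" using pq by (auto simp: overlap_def s_def)
      then show ?thesis using 4 layout_order[OF B(1)] by blast
    qed
  qed
  moreover have "card (C x) \<le> w1 x + w2 x" for x
  proof -
    have fBx: "finite (B x)" using fB by (rule finite_subset[rotated]) auto
    have "card (C x) \<le> card (A x) + card (s ` B x)" unfolding C_def by (rule card_Un_le)
    also have "\<dots> \<le> card (A x) + card (B x)" using fBx by (intro add_mono card_image_le) auto
    finally show ?thesis using A(2) B(2) by (meson add_mono order_trans)
  qed
  moreover have "realizes C x y" if "(x, y) \<in> E1" for x y
  proof -
    have "realizes A x y" using A(3) that by auto
    then obtain p q where pq: "p \<in> A x" "q \<in> A y" and sees: "sees (\<Union>x. A x) p q"
      unfolding realizes_def by blast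
    then obtain a b where ab: "a < b" "lft p \<le> a" "b \<le> rgt p" "lft q \<le> a" "b \<le> rgt q"
       "\<forall>c\<in>(\<Union>x. A x). hgt p < hgt c \<longrightarrow> hgt c < hgt q \<longrightarrow> rgt c \<le> a \<or> b \<le> lft c"
      unfolding sees_bars_iff[OF barsA] by blast
    \<comment> \<open>The channel ends at or before \<open>M\<close>, whereas every translated bar
      starts at or after \<open>M\<close>.\<close>
    have "b \<le> lft (s c)" if "c \<in> (\<Union>x. B x)" for c
    proof -
      from that obtain z where "c \<in> B z" by blast
      then show ?thesis using BM(2) AM(2)[OF pq(1)] ab(3) by (force simp: s_def)
    qed
    then have "\<forall>c\<in>(\<Union>x. C x). hgt p < hgt c \<longrightarrow> hgt c < hgt q \<longrightarrow> rgt c \<le> a \<or> b \<le> lft c"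
      using ab(6) unfolding UC by (simp add: ball_Un)
    then have "sees (\<Union>x. C x) p q"
      unfolding sees_bars_iff[OF barsC] using sees_overlap[OF sees] ab(1-5) by blast
    then show ?thesis using pq by (auto simp: realizes_def C_def)
  qed
  moreover have "realizes C x y" if "(x, y) \<in> E2" for x y
  proof -
    have "realizes B x y" using B(3) that by auto
    then obtain p q where pq: "p \<in> B x" "q \<in> B y" and sees: "sees (\<Union>x. B x) p q"
      unfolding realizes_def by blast
    then obtain a b where ab: "a < b" "lft p \<le> a" "b \<le> rgt p" "lft q \<le> a" "b \<le> rgt q"
       "\<forall>c\<in>(\<Union>x. B x). hgt p < hgt c \<longrightarrow> hgt c < hgt q \<longrightarrow> rgt c \<le> a \<or> b \<le> lft c"
      unfolding sees_bars_iff[OF barsB] by blast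
    have "rgt c \<le> a + (M - m)" if "c \<in> (\<Union>x. A x)" for c
    proof -
      from that obtain z where "c \<in> A z" by blast
      then show ?thesis using BM(2)[OF pq(1)] AM(2) ab(2) by force
    qed
    then have "\<forall>c\<in>(\<Union>x. C x). hgt (s p) < hgt c \<longrightarrow> hgt c < hgt (s q) \<longrightarrow>
        rgt c \<le> a + (M - m) \<or> b + (M - m) \<le> lft c"
      using ab(6) unfolding UC by (simp add: ball_Un s_def)
    then have "sees (\<Union>x. C x) (s p) (s q)"
      unfolding sees_bars_iff[OF barsC] using sees_overlap[OF sees] ab(1-5)
      by (intro conjI exI[of _ "a + (M - m)"] exI[of _ "b + (M - m)"]) (simp_all add: s_def)
    then show ?thesis using pq by (auto simp: realizes_def C_def)
  qed
  ultimately show ?thesis unfolding drawable_def by (intro exI[of _ C]) auto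
qed

lemma drawable_empty: "drawable w {}"
  unfolding drawable_def by (intro exI[of _ "\<lambda>_. {}"]) (simp add: layout_def)

lemma drawable_UN:
  assumes "finite I" "\<And>i. i \<in> I \<Longrightarrow> drawable (w i) (E i)"
  shows "drawable (\<lambda>x. \<Sum>i\<in>I. w i x) (\<Union>i\<in>I. E i)"
  using assms by (induction I rule: finite_induct) (auto simp: drawable_empty intro: drawable_union)

lemma drawable_edge:
  assumes "x < y"
  shows "drawable (\<lambda>z. if z \<in> {x, y} then 1 else 0) {(x, y)}"
proof -
  define B where "B z = (if z = x then {Bar 0 1 0} else if z = y then {Bar 0 1 1} else {})" for z
  have S: "(\<Union>z. B z) = {Bar 0 1 0, Bar 0 1 1}" using assms by (auto simp: B_def split: if_splits)
  have "layout B"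
    unfolding layout_def S using assms
    by (auto simp: B_def is_bar_def non_overlapping_def split: if_splits)
  moreover have "sees (\<Union>z. B z) (Bar 0 1 0) (Bar 0 1 1)"
    unfolding sees_def S by (intro conjI exI[of _ 0] exI[of _ 1]) (auto simp: segment_def)
  then have "realizes B x y"
    unfolding realizes_def using assms by (auto simp: B_def)
  moreover have "card (B z) \<le> (if z \<in> {x, y} then 1 else 0)" for z
    by (auto simp: B_def)
  ultimately show ?thesis unfolding drawable_def by blast
qed

section \<open>Transitive tournaments\<close>

text \<open>The transitive tournament on an arbitrary vertex set \<open>V\<close>, with at most
  \<open>t\<close> bars per vertex; the general \<open>V\<close> lets copies of small tournaments be
  placed inside a large one.\<close>

definition tdrawable :: "nat \<Rightarrow> nat set \<Rightarrow> bool" where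
  "tdrawable t V \<longleftrightarrow> drawable (\<lambda>x. if x \<in> V then t else 0) {(x, y) \<in> V \<times> V. x < y}"

text \<open>Applied to initial segments, this is the monotonicity of the bar visibility number of
  transitive tournaments.\<close>

lemma tdrawable_subset:
  assumes "tdrawable t V" "W \<subseteq> V"
  shows "tdrawable t W"
proof -
  note drawable_restrict[OF assms(1)[unfolded tdrawable_def], of W]
  then show ?thesis
    unfolding tdrawable_def by (rule drawable_mono) (use assms(2) in auto)
qed

lemma tdrawable_image:
  assumes "tdrawable t V" "strict_mono_on V g"
  shows "tdrawable t (g ` V)"
proof -
  have "x < y" if "x \<in> V" "y \<in> V" "g x < g y" for x y
    using that strict_mono_onD[OF assms(2), of y x] by (cases x y rule: linorder_cases) auto
  then have sub: "{(x, y) \<in> g ` V \<times> g ` V. x < y} \<subseteq>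
      map_prod g g ` ({(x, y) \<in> V \<times> V. x < y} \<inter> V \<times> V)"
    by auto
  from drawable_relabel[OF assms(1)[unfolded tdrawable_def] assms(2)] show ?thesis
    unfolding tdrawable_def by (rule drawable_mono[OF _ _ sub]) simp
qed

lemma tdrawable_1_pair:
  assumes "x < y"
  shows "tdrawable 1 {x, y}"
proof -
  have "{(a, b) \<in> {x, y} \<times> {x, y}. a < b} = {(x, y)}" using assms by auto
  then show ?thesis using drawable_edge[OF assms] by (simp only: tdrawable_def)
qed

section \<open>Covering arcs by subtournaments, and the blow-up\<close>

lemma drawable_cover:
  assumes "finite I" "\<And>i. i \<in> I \<Longrightarrow> tdrawable t (V i)"
    and "\<And>x. x \<in> W \<Longrightarrow> card {i \<in> I. x \<in> V i} \<le> c"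
    and "E \<subseteq> {(x, y) \<in> W \<times> W. x < y \<and> (\<exists>i\<in>I. x \<in> V i \<and> y \<in> V i)}"
  shows "drawable (\<lambda>x. if x \<in> W then c * t else 0) E"
proof -
  \<comment> \<open>Draw all the tournaments on the sets \<open>V i\<close> side by side: a vertex
    pays \<open>t\<close> for each \<open>V i\<close> containing it. Restricting to \<open>W\<close>
    then keeps only vertices whose multiplicity is bounded by \<open>c\<close>.\<close>
  have "drawable (\<lambda>x. \<Sum>i\<in>I. if x \<in> V i then t else 0) (\<Union>i\<in>I. {(x, y) \<in> V i \<times> V i. x < y})"
    using assms(2) by (intro drawable_UN assms(1)) (simp only: tdrawable_def)
  note drawable_restrict[OF this, of W]
  moreover have "(\<Sum>i\<in>I. if x \<in> V i then t else 0) \<le> c * t" if "x \<in> W" for x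
    using assms(1) assms(3)[OF that] by (simp flip: sum.inter_filter)
  ultimately show ?thesis
    by (elim drawable_mono) (use assms(4) in auto)
qed

text \<open>A crude bound from drawing every arc separately. It ensures that the least number of
  bars exists and later bounds the cost of the arcs inside a group.\<close>

lemma tdrawable_self: "tdrawable n {..<n}"
proof -
  let ?I = "{(x, y) \<in> {..<n} \<times> {..<n}. x < y}" and ?V = "\<lambda>(x, y). {x, y}"
  have "drawable (\<lambda>x. if x \<in> {..<n} then n * 1 else 0) ?I"
  proof (rule drawable_cover)
    show fin: "finite ?I" by (rule finite_subset[of _ "{..<n} \<times> {..<n}"]) auto
    show "tdrawable 1 (?V i)" if "i \<in> ?I" for i
      using that tdrawable_1_pair by auto
    show "card {i \<in> ?I. z \<in> ?V i} \<le> n" if "z \<in> {..<n}" for z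
    proof -
      \<comment> \<open>A pair containing \<open>z\<close> is determined by its other
        element.\<close>
      have "card {i \<in> ?I. z \<in> ?V i} \<le> card {..<n}"
        by (rule card_inj_on_le[of "\<lambda>(x, y). if z = x then y else x"])
          (auto simp: inj_on_def split: if_splits)
      then show ?thesis by simp
    qed
  qed auto
  then show ?thesis by (simp only: tdrawable_def mult_1_right)
qed

text \<open>Read \<open>x\<close> as the point with column \<open>x div k\<close> and residue
  \<open>x mod k\<close>. Then \<open>g (r, s)\<close> traces the line with slope \<open>r\<close>
  and intercept \<open>s\<close> modulo \<open>k\<close>, meeting each column once. Vertices in
  different columns compare by column, so every line carries a copy of the small tournament;
  \<open>h i\<close> enumerates column \<open>i\<close>.\<close>

lemma tdrawable_blow_up:
  assumes n: "tdrawable t {..<n}" and k: "tdrawable s {..<k}" and cop: "coprime k (fact n)"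
  shows "tdrawable (k * t + s) {..<n * k}"
proof (cases "k = 0")
  case True
  then show ?thesis by (simp add: tdrawable_def drawable_empty)
next
  case False
  then have k0: "k > 0" by simp
  let ?W = "{..<n * k}"
  define g where "g = (\<lambda>(r, s) i. i * k + (r * i + s) mod k)"
  define h where "h i x = i * k + x" for i x
  have g_div: "g c i div k = i" for c i using k0 by (cases c) (simp add: g_def)
  have g_mod: "g (r, s) i mod k = (r * i + s) mod k" for r s i by (simp add: g_def)
  have "strict_mono_on {..<n} (g c)" for c
  proof (rule strict_mono_onI)
    fix i j :: nat assume "i < j"
    then show "g c i < g c j" by (metis g_div div_le_mono leD not_less)
  qed
  then have gt: "tdrawable t (g c ` {..<n})" for c
    by (rule tdrawable_image[OF n])
  have ht: "tdrawable s (h i ` {..<k})" for i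
    by (rule tdrawable_image[OF k]) (simp add: h_def strict_mono_on_def)
  have hI: "x \<in> h (x div k) ` {..<k}" for x
    using k0 by (auto simp: h_def image_iff intro!: bexI[of _ "x mod k"])
  have gcard: "card {c \<in> {..<k} \<times> {..<k}. x \<in> g c ` {..<n}} \<le> k" if "x \<in> ?W" for x
  proof -
    have "card {c \<in> {..<k} \<times> {..<k}. x \<in> g c ` {..<n}} \<le> card {..<k}"
    \<comment> \<open>The column of \<open>x\<close> is known, so a line through \<open>x\<close> is
      determined by its slope.\<close>
    proof (rule card_inj_on_le[of fst])
      show "inj_on fst {c \<in> {..<k} \<times> {..<k}. x \<in> g c ` {..<n}}"
      proof (clarsimp simp: inj_on_def)
        fix r s i s' j
        assume s: "s < k" "s' < k" and eq: "g (r, s) i = g (r, s') j"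
        from eq have "i = j" by (metis g_div)
        then have "[r * i + s = r * i + s'] (mod k)" using eq g_mod by (metis cong_def)
        then show "s = s'" using s by (simp add: cong_add_lcancel_nat cong_less_modulus_unique_nat)
      qed
    qed auto
    then show ?thesis by simp
  qed
  have hcard: "card {i \<in> {..<n}. x \<in> h i ` {..<k}} \<le> 1" if "x \<in> ?W" for x
  proof -
    have "{i \<in> {..<n}. x \<in> h i ` {..<k}} \<subseteq> {x div k}" by (auto simp: h_def)
    from card_mono[OF _ this] show ?thesis by simp
  qed
  have cover: "\<exists>c\<in>{..<k} \<times> {..<k}. x \<in> g c ` {..<n} \<and> y \<in> g c ` {..<n}"
    if "x \<in> ?W" "y \<in> ?W" "x div k < y div k" for x y
  proof -
    let ?i = "x div k" and ?j = "y div k"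
    have j: "?i < n" "?j < n" using that by (auto simp: less_mult_imp_div_less)
    \<comment> \<open>The column difference is positive and at most \<open>n\<close>; this is where
      coprimality with the factorial enters.\<close>
    have "?j - ?i dvd fact n" using that j by (intro dvd_fact) auto
    then have "coprime (?j - ?i) k" using cop by (meson coprime_commute coprime_divisors dvd_refl)
    then obtain u where u: "[(?j - ?i) * u = 1] (mod k)" using cong_solve_coprime_nat by auto
    \<comment> \<open>The line through both points: slope \<open>(y - x) / (j - i)\<close> and
      intercept \<open>x - r * i\<close> modulo \<open>k\<close>, with \<open>k - 1\<close> standing
      for \<open>-1\<close> to stay within the naturals.\<close>
    define r where "r = u * (y + (k - 1) * x)"
    define s where "s = x + (k - 1) * r * ?i"
    have ri: "[r * ?i + s = x] (mod k)"
    proof -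
      have "r * ?i + s = x + k * (r * ?i)" using k0 by (cases k) (auto simp: s_def algebra_simps)
      then show ?thesis by (simp add: cong_def)
    qed
    have "[r * ?j + s = y] (mod k)"
    proof -
      have "?j = (?j - ?i) + ?i" using that by simp
      then have "r * ?j + s = r * (?j - ?i) + (r * ?i + s)" by (metis add.assoc distrib_left)
      moreover have "r * (?j - ?i) = ((?j - ?i) * u) * (y + (k - 1) * x)" by (simp add: r_def)
      ultimately have "[r * ?j + s = 1 * (y + (k - 1) * x) + x] (mod k)"
        using cong_add[OF cong_mult[OF u cong_refl] ri] by metis
      moreover have "1 * (y + (k - 1) * x) + x = y + k * x" using k0 by (cases k) auto
      ultimately have "[r * ?j + s = y + k * x] (mod k)" by metis
      then show ?thesis by (simp add: cong_def)
    qed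
    \<comment> \<open>Reducing slope and intercept modulo \<open>k\<close> does not change the line,
      and brings the index into the range of the cover.\<close>
    with ri have "g (r mod k, s mod k) ?i = x" "g (r mod k, s mod k) ?j = y"
      using mod_add_cong[OF mod_mult_cong[OF mod_mod_trivial refl] mod_mod_trivial, of r k _ s]
      by (simp_all add: g_def cong_def)
    then show ?thesis using j k0
      by (intro bexI[of _ "(r mod k, s mod k)"] conjI image_eqI[of _ _ ?i] image_eqI[of _ _ ?j]) simp_all
  qed
  define E where "E = {(x, y) \<in> ?W \<times> ?W. x < y \<and> x div k < y div k}"
  define F where "F = {(x, y) \<in> ?W \<times> ?W. x < y \<and> x div k = y div k}"
  have "drawable (\<lambda>x. if x \<in> ?W then k * t else 0) E"
    by (rule drawable_cover[OF _ gt gcard]) (use cover in \<open>auto simp: E_def\<close>)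
  moreover have "drawable (\<lambda>x. if x \<in> ?W then 1 * s else 0) F"
  proof (rule drawable_cover[OF _ ht hcard])
    show "F \<subseteq> {(x, y) \<in> ?W \<times> ?W. x < y \<and> (\<exists>i\<in>{..<n}. x \<in> h i ` {..<k} \<and> y \<in> h i ` {..<k})}"
    proof (clarify, intro conjI)
      fix x y assume "(x, y) \<in> F"
      then have "x div k < n" "x div k = y div k" by (auto simp: F_def less_mult_imp_div_less)
      with hI[of x] hI[of y] show "\<exists>i\<in>{..<n}. x \<in> h i ` {..<k} \<and> y \<in> h i ` {..<k}"
        by (intro bexI[of _ "x div k"]) simp_all
    qed (auto simp: F_def)
  qed simp_all
  ultimately have "drawable (\<lambda>x. (if x \<in> ?W then k * t else 0) + (if x \<in> ?W then 1 * s else 0)) (E \<union> F)"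
    by (rule drawable_union)
  then show ?thesis unfolding tdrawable_def
    by (rule drawable_mono) (auto simp: E_def F_def intro!: le_neq_implies_less[OF div_le_mono])
qed

section \<open>Equivalence with bar visibility representations\<close>

lemma bar_visibility_rep_iff_tdrawable:
  "(\<exists>B. bar_visibility_rep t (with_proj (transitive_tournament n)) B) \<longleftrightarrow> tdrawable t {1..n}"
proof -
  let ?G = "with_proj (transitive_tournament n)" and ?V = "{1..n}"
  have verts: "verts ?G = ?V" by (simp add: transitive_tournament_def)
  have arcs: "x \<rightarrow>\<^bsub>?G\<^esub> y \<longleftrightarrow> x \<in> ?V \<and> y \<in> ?V \<and> x < y" for x y
    by (auto simp: transitive_tournament_def arcs_ends_conv)
  show ?thesis
  proof
    assume "\<exists>B. bar_visibility_rep t ?G B"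
    then obtain B where "bar_visibility_rep t ?G B" by blast
    then have B: "\<forall>x\<in>?V. finite (B x) \<and> card (B x) \<le> t" "\<forall>x\<in>?V. \<forall>p\<in>B x. is_bar p"
        "\<forall>x\<in>?V. \<forall>y\<in>?V. \<forall>p\<in>B x. \<forall>q\<in>B y. (x, p) \<noteq> (y, q) \<longrightarrow> non_overlapping p q"
      and vis: "\<And>x y. x \<in> ?V \<Longrightarrow> y \<in> ?V \<Longrightarrow> x \<noteq> y \<Longrightarrow>
        x < y \<longleftrightarrow> (\<exists>p\<in>B x. \<exists>q\<in>B y. sees (\<Union>z\<in>?V. B z) p q)"
      unfolding bar_visibility_rep_def verts arcs by simp_all
    \<comment> \<open>A representation says nothing about \<open>B\<close> outside the vertex set,
      while \<open>layout\<close> ranges over all naturals.\<close>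
    define C where "C x = (if x \<in> ?V then B x else {})" for x
    have UC: "(\<Union>x. C x) = (\<Union>z\<in>?V. B z)" by (auto simp: C_def split: if_splits)
    have fin: "finite (\<Union>x. C x)" using B(1) by (simp add: UC)
    have bars: "is_bar p" if "p \<in> C x" for x p using that B(2) by (auto simp: C_def split: if_splits)
    have ord: "x \<le> y" if "p \<in> C x" "q \<in> C y" "sees (\<Union>x. C x) p q" for x y p q
    proof (rule ccontr)
      assume "\<not> x \<le> y"
      moreover have xy: "x \<in> ?V" "p \<in> B x" "y \<in> ?V" "q \<in> B y"
        using that by (auto simp: C_def split: if_splits)
      ultimately have "x < y" using vis[of x y] that(3) unfolding UC by auto
      with \<open>\<not> x \<le> y\<close> show False by simp
    qed
    have "layout C"
      unfolding layout_def
    proof (intro conjI allI ballI impI)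
      fix x y p q assume "p \<in> C x" "q \<in> C y" "(x, p) \<noteq> (y, q)"
      then show "non_overlapping p q" using B(3) by (auto simp: C_def split: if_splits)
    qed (use fin bars sees_order_imp_overlap_order[OF fin bars ord] in auto)
    moreover have "realizes C x y" if "x \<in> ?V" "y \<in> ?V" "x < y" for x y
    proof -
      have "C x = B x" "C y = B y" using that by (simp_all add: C_def)
      then show ?thesis using vis[of x y] that unfolding realizes_def UC by simp
    qed
    ultimately show "tdrawable t ?V"
      using B(1) unfolding tdrawable_def drawable_def by (intro exI[of _ C]) (auto simp: C_def)
  next
    assume "tdrawable t ?V"
    then obtain B where B: "layout B" "\<And>x. card (B x) \<le> (if x \<in> ?V then t else 0)"
        "\<And>x y. x \<in> ?V \<Longrightarrow> y \<in> ?V \<Longrightarrow> x < y \<Longrightarrow> realizes B x y"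
      unfolding tdrawable_def drawable_def by auto
    have fin: "finite (B x)" for x
      using layout_finite[OF B(1)] by (rule finite_subset[rotated]) auto
    \<comment> \<open>Finiteness matters here, since \<open>card\<close> is also 0 on infinite
      sets.\<close>
    have "B x = {}" if "x \<notin> ?V" for x using B(2)[of x] fin[of x] that by auto
    then have UB: "(\<Union>z\<in>?V. B z) = (\<Union>z. B z)" by blast
    \<comment> \<open>Visibilities beyond the required ones are therefore arcs as well, which gives
      the converse direction of the representation condition.\<close>
    have "x < y" if "x \<noteq> y" "p \<in> B x" "q \<in> B y" "sees (\<Union>z. B z) p q" for x y p q
    proof -
      have "x \<le> y" using B(1) that(2,3) sees_overlap[OF that(4)] unfolding layout_def by blast
      with that(1) show ?thesis by simp
    qed
    moreover have "card (B x) \<le> t" if "x \<in> ?V" for x using B(2)[of x] that by simp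
    ultimately have "bar_visibility_rep t ?G B"
      unfolding bar_visibility_rep_def verts arcs UB using fin B(3) B(1)[unfolded layout_def]
      by (auto simp: realizes_def)
    then show "\<exists>B. bar_visibility_rep t ?G B" by blast
  qed
qed

text \<open>Numbering from 0 suits the division by \<open>k\<close> in the blow-up.\<close>

lemma tdrawable_atLeastAtMost: "tdrawable t {1..n} \<longleftrightarrow> tdrawable t {..<n}"
proof -
  have "strict_mono_on {..<n} Suc" "strict_mono_on {1..n} (\<lambda>x. x - 1)"
    by (auto simp: strict_mono_on_def)
  moreover have "Suc ` {..<n} = {1..n}" by (auto simp: image_Suc_lessThan)
  moreover have "(\<lambda>x. x - 1) ` {1..n} = {..<n}" 
    by (auto simp: image_iff intro!: bexI[of _ "Suc _"])
  ultimately show ?thesis using tdrawable_image by metis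
qed

abbreviation bT :: "nat \<Rightarrow> nat" where
  "bT n \<equiv> bar_visibility_number (with_proj (transitive_tournament n))"

lemma bT_eq_Least: "bT n = (LEAST t. tdrawable t {..<n})"
  by (simp only: bar_visibility_number_def bar_visibility_rep_iff_tdrawable tdrawable_atLeastAtMost)

lemma tdrawable_bT: "tdrawable (bT n) {..<n}"
  unfolding bT_eq_Least by (rule LeastI[of _ n]) (rule tdrawable_self)

lemma bT_le: "tdrawable t {..<n} \<Longrightarrow> bT n \<le> t"
  unfolding bT_eq_Least by (rule Least_le)

text \<open>Spending \<open>k\<close> bars per vertex inside the groups suffices: relative to
  \<open>n * k\<close> vertices this costs only \<open>1 / n\<close>.\<close>

lemma bT_blow_up_le:
  assumes "coprime k (fact n)" "N \<le> n * k"
  shows "bT N \<le> k * (bT n + 1)"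
proof -
  have "tdrawable (k * bT n + k) {..<n * k}"
    by (rule tdrawable_blow_up[OF tdrawable_bT tdrawable_self assms(1)])
  then have "tdrawable (k * bT n + k) {..<N}" by (rule tdrawable_subset) (use assms(2) in auto)
  then show ?thesis using bT_le by (simp add: algebra_simps)
qed

section \<open>Convergence\<close>

text \<open>A variant of Fekete's argument: the limit is the infimum of \<open>f n + e n\<close>.
  Each \<open>f n\<close> is at least this infimum minus \<open>e n\<close>, and \<open>le\<close>
  bounds the limes superior from above by every \<open>f n + e n\<close>.\<close>

lemma convergent_if_eventually_le_Inf:
  fixes f e :: "nat \<Rightarrow> real"
  assumes nonneg: "\<And>n. 0 \<le> f n" "\<And>n. 0 \<le> e n" and e: "e \<longlonglongrightarrow> 0"
    and le: "\<And>n \<epsilon>. n \<ge> 1 \<Longrightarrow> \<epsilon> > 0 \<Longrightarrow> eventually (\<lambda>N. f N \<le> f n + e n + \<epsilon>) sequentially"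
  shows "convergent f"
proof -
  \<comment> \<open>Index 0 is left out: in the application division by zero makes both terms 0
    there, which would spoil the infimum.\<close>
  define L where "L = (INF n\<in>{1..}. f n + e n)"
  have bdd: "bdd_below ((\<lambda>n. f n + e n) ` {1..})"
    by (rule bdd_belowI2[of _ 0]) (simp add: nonneg)
  have lower: "L - e n \<le> f n" if "n \<ge> 1" for n
    using cINF_lower[OF bdd, of n] that by (simp add: L_def)
  have "f \<longlonglongrightarrow> L"
  proof (rule tendstoI)
    fix \<epsilon> :: real assume "\<epsilon> > 0"
    then have "L < L + \<epsilon> / 2" by simp
    then obtain n where n: "n \<ge> 1" "f n + e n < L + \<epsilon> / 2"
      using cINF_less_iff[OF _ bdd, of "L + \<epsilon> / 2"] unfolding L_def by auto
    have "eventually (\<lambda>N. f N \<le> f n + e n + \<epsilon> / 2) sequentially"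
      using le[OF n(1)] \<open>\<epsilon> > 0\<close> by simp
    moreover have "eventually (\<lambda>N. e N < \<epsilon>) sequentially"
      using order_tendstoD(2)[OF e \<open>\<epsilon> > 0\<close>] .
    ultimately show "eventually (\<lambda>N. dist (f N) L < \<epsilon>) sequentially"
      using eventually_ge_at_top[of 1]
    proof eventually_elim
      case (elim N)
      then show ?case using lower[of N] n by (simp add: dist_real_def abs_less_iff)
    qed
  qed
  then show ?thesis by (rule convergentI)
qed

theorem theorem3p3:
  shows "convergent (\<lambda>n. real (bar_visibility_number (with_proj (transitive_tournament n))) / real n)"
proof (rule convergent_if_eventually_le_Inf[where e = "\<lambda>n. 1 / real n"])
  show "(\<lambda>n. 1 / real n) \<longlonglongrightarrow> 0" by (rule lim_1_over_n)
next
  fix n :: nat and \<epsilon> :: real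
  assume n: "n \<ge> 1" and "\<epsilon> > 0"
  \<comment> \<open>A bound, independent of \<open>N\<close>, for the excess of \<open>n * k\<close>
    over \<open>N\<close> with the \<open>k\<close> chosen below.\<close>
  define c where "c = n + n * fact n"
  define \<beta> where "\<beta> = (real (bT n) + 1) / real n"
  have bound: "real (bT N) / real N \<le> \<beta> + \<beta> * real c * (1 / real N)" if N: "N \<ge> 1" for N
  proof -
    define d where "d = n * fact n"
    \<comment> \<open>Congruent to 1 modulo \<open>fact n\<close>, hence coprime to it. Rounding the
      quotient up makes \<open>n * k\<close> exceed \<open>N\<close>, by at most
      \<open>n + d\<close>.\<close>
    define k where "k = 1 + (N div d + 1) * fact n"
    have "d > 0" using n by (simp add: d_def)
    have nk: "n * k = n + (N div d) * d + d" by (simp add: k_def d_def algebra_simps)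
    have "N \<le> (N div d) * d + d" using \<open>d > 0\<close>
      by (metis div_mult_mod_eq add_left_mono less_imp_le mod_less_divisor)
    then have "N \<le> n * k" using nk by simp
    moreover have "coprime k (fact n)"
      unfolding k_def by (metis coprime_1_left coprime_iff_gcd_eq_1 gcd_add_mult add.commute gcd.commute)
    ultimately have "bT N \<le> k * (bT n + 1)" by (rule bT_blow_up_le[rotated])
    then have "real (bT N) \<le> real (k * (bT n + 1))" by (simp only: of_nat_le_iff)
    also have "\<dots> = real (n * k) * \<beta>" using n by (simp add: \<beta>_def field_simps)
    also have "\<dots> \<le> real (N + c) * \<beta>"
    proof (rule mult_right_mono)
      have "(N div d) * d \<le> N" by simp
      then have "n * k \<le> N + c" using nk by (simp add: c_def d_def)
      then show "real (n * k) \<le> real (N + c)" by (simp only: of_nat_le_iff)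
    qed (simp add: \<beta>_def)
    finally show ?thesis using N by (simp add: field_simps)
  qed
  have "(\<lambda>N. \<beta> + \<beta> * real c * (1 / real N)) \<longlonglongrightarrow> \<beta> + \<beta> * real c * 0"
    by (intro tendsto_intros lim_1_over_n)
  then have "eventually (\<lambda>N. \<beta> + \<beta> * real c * (1 / real N) < \<beta> + \<epsilon>) sequentially"
    by (rule order_tendstoD) (use \<open>\<epsilon> > 0\<close> in simp)
  then show "eventually (\<lambda>N. real (bT N) / real N \<le> real (bT n) / real n + 1 / real n + \<epsilon>) sequentially"
    using eventually_ge_at_top[of 1]
  proof eventually_elim
    case (elim N)
    then show ?case using bound[of N] by (simp add: \<beta>_def add_divide_distrib)
  qed
qed simp_all

end
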